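(* Let $M$ be a partially ordered monoid with a family of null sequences $N(M)$, let $(X,d_{X,M})$ be a complete $FM$-distance space, and let $f\colon X\to X$. Assume that there exists $\lambda\in\mathcal{L}(N(M))$ such that $$d_{X,M}(f(x),f(y))\leq \lambda(d_{X,M}(x,y))\quad\text{for all } x,y\in X.$$ Then $f$ has a unique fixed point, and for every choice of $x_0\in X$ this fixed point is the limit of the sequence $x_n=f(x_{n-1})$, $n\in\mathbb{N}$.
   Context: A monoid $M$ is a set with an associative binary operation $+$ (not assumed commutative) and a two-sided neutral element $\theta_M$. A partially ordered monoid is a monoid $M$ with a partial order $\le$ (reflexive, transitive, antisymmetric) such that $M_+:=\{x\in M:\theta_M\le x\}\neq\{\theta_M\}$ and $x_1\le y_1$, $x_2\le y_2$ imply $x_1+x_2\le y_1+y_2$. A family of null sequences $N(M)$ is a family of sequences in $M_+$ such that: (1) the constant sequence $\{\theta_M\}$ is in $N(M)$, and if a constant sequence $\{x,x,\ldots\}$, $x\in M_+$, is in $N(M)$ then $x=\theta_M$; (2) $\{x_n\},\{y_n\}\in N(M)$ implies $\{x_n+y_n\}\in N(M)$; (3) $\{x_n\}\in N(M)$ and $\theta_M\le y_n\le x_n$ for all $n\in\mathbb{N}$ imply $\{y_n\}\in N(M)$; (4) substitution, addition or removal of finitely many elements of a sequence of $N(M)$ (elements of $M_+$) preserves membership in $N(M)$; (5) each subsequence of a sequence of $N(M)$ is in $N(M)$. A family $N(M)$ is fixed. "Increasing" sequences of natural numbers are strictly increasing. For $\{x_n\}\subset M_+$, the series $\sum_{n=1}^\infty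 x_n$ is a Cauchy series if for all increasing sequences of natural numbers $\{n_k\},\{m_k\}$ with $m_k\ge n_k$ for all $k$ one has $\{\sum_{s=n_k}^{m_k}x_s\}_k\in N(M)$. An $M$-valued distance on a set $X$ is a map $d_{X,M}\colon X\times X\to M_+$ with $d_{X,M}(x,y)=d_{X,M}(y,x)$ and $d_{X,M}(x,y)=\theta_M\iff x=y$. Then $(X,d_{X,M})$ is an $M$-distance space. A sequence $\{x_n\}\subset X$ converges to $x\in X$ if $\{d_{X,M}(x_n,x)\}\in N(M)$; it is a Cauchy sequence if $\{d_{X,M}(x_{n_k},x_{m_k})\}_k\in N(M)$ for all increasing sequences of natural numbers $\{n_k\},\{m_k\}$ with $m_k>n_k$ for all $k$. $(X,d_{X,M})$ is an $FM$-distance space ($FM$-space) if it has the strong Fréchet–Wilson property: for every sequence $\{x_n\}\subset X$ and all increasing sequences of natural numbers $\{n_k\},\{m_k\}$ with $m_k>n_k$ for all $k$, $\{\sum_{s=n_k}^{m_k-1}d_{X,M}(x_s,x_{s+1})\}_k\in N(M)$ implies $\{d_{X,M}(x_{n_k},x_{m_k})\}_k\in N(M)$. It is complete if each Cauchy sequence converges to an element of $X$. $\mathcal{L}(N(M))$ is the class of maps $\lambda\colon M_+\to M_+$ such that: (1) $x\le y$ implies $\lambda(x)\le\lambda(y)$; (2) $\{x_n\}\in N(M)$ implies $\{\lambda(x_n)\}\in N(M)$; (3) for every $\alpha\in M_+$, $\sum_{n=1}^\infty\lambda^n(\alpha)$ is a Cauchy series, where $\lambda^n$ is the $n$-fold iterate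 of $\lambda$. *)

theory Defs imports Main begin

text \<open>Addition is not assumed commutative, so the library's classes of ordered monoids (all
  commutative) do not apply, and finite sums in this file are the ordered ones, \<open>sum_list\<close>.\<close>

class partially_ordered_monoid = order + monoid_add +
  assumes po_add_mono: "x1 \<le> y1 \<Longrightarrow> x2 \<le> y2 \<Longrightarrow> x1 + x2 \<le> y1 + y2"
    and nontrivial_nonneg: "{x. 0 \<le> x} \<noteq> {0}"

text \<open>Sequences are functions on \<open>nat\<close>: the term of index \<open>n + 1\<close> of a sequence indexed by
  \<open>1, 2, \<dots>\<close> is the value at \<open>n\<close>. In \<open>add_finite\<close> and \<open>remove_finite\<close> the
  function \<open>r\<close> enumerates the positions of the longer sequence that the shorter one keeps.\<close>

locale null_sequences =
  fixes N :: "(nat \<Rightarrow> 'm::partially_ordered_monoid) set"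
  assumes nonneg: "x \<in> N \<Longrightarrow> 0 \<le> x n"
    and const_zero: "(\<lambda>n. 0) \<in> N"
    and const_imp_zero: "0 \<le> c \<Longrightarrow> (\<lambda>n. c) \<in> N \<Longrightarrow> c = 0"
    and add: "x \<in> N \<Longrightarrow> y \<in> N \<Longrightarrow> (\<lambda>n. x n + y n) \<in> N"
    and dominated: "x \<in> N \<Longrightarrow> (\<And>n. 0 \<le> y n \<and> y n \<le> x n) \<Longrightarrow> y \<in> N"
    and substitute_finite:
      "x \<in> N \<Longrightarrow> (\<And>n. 0 \<le> y n) \<Longrightarrow> finite {n. y n \<noteq> x n} \<Longrightarrow> y \<in> N"
    and add_finite:
      "(\<lambda>n. y (r n)) \<in> N \<Longrightarrow> (\<And>n. 0 \<le> y n) \<Longrightarrow> strict_mono r \<Longrightarrow> finite (- range r) \<Longrightarrow> y \<in> N"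
    and remove_finite:
      "x \<in> N \<Longrightarrow> strict_mono r \<Longrightarrow> finite (- range r) \<Longrightarrow> (\<lambda>n. x (r n)) \<in> N"
    and subsequence: "x \<in> N \<Longrightarrow> strict_mono r \<Longrightarrow> (\<lambda>n. x (r n)) \<in> N"

definition Cauchy_series ::
    "(nat \<Rightarrow> 'm::partially_ordered_monoid) set \<Rightarrow> (nat \<Rightarrow> 'm) \<Rightarrow> bool" where
  "Cauchy_series N a \<longleftrightarrow> (\<forall>n. 0 \<le> a n) \<and>
    (\<forall>n m. strict_mono n \<and> strict_mono m \<and> (\<forall>k. n k \<le> m k) \<longrightarrow>
      (\<lambda>k. sum_list (map a [n k..<Suc (m k)])) \<in> N)"

locale distance_space =
  fixes X :: "'a set" and d :: "'a \<Rightarrow> 'a \<Rightarrow> 'm::partially_ordered_monoid"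
  assumes dist_nonneg: "x \<in> X \<Longrightarrow> y \<in> X \<Longrightarrow> 0 \<le> d x y"
    and dist_sym: "x \<in> X \<Longrightarrow> y \<in> X \<Longrightarrow> d x y = d y x"
    and dist_eq_zero: "x \<in> X \<Longrightarrow> y \<in> X \<Longrightarrow> d x y = 0 \<longleftrightarrow> x = y"

definition converges_to ::
    "(nat \<Rightarrow> 'm::partially_ordered_monoid) set \<Rightarrow> 'a set \<Rightarrow> ('a \<Rightarrow> 'a \<Rightarrow> 'm) \<Rightarrow> (nat \<Rightarrow> 'a) \<Rightarrow> 'a \<Rightarrow> bool"
  where "converges_to N X d x l \<longleftrightarrow> range x \<subseteq> X \<and> l \<in> X \<and> (\<lambda>n. d (x n) l) \<in> N"

definition Cauchy_sequence ::
    "(nat \<Rightarrow> 'm::partially_ordered_monoid) set \<Rightarrow> 'a set \<Rightarrow> ('a \<Rightarrow> 'a \<Rightarrow> 'm) \<Rightarrow> (nat \<Rightarrow> 'a) \<Rightarrow> bool"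
  where "Cauchy_sequence N X d x \<longleftrightarrow> range x \<subseteq> X \<and>
    (\<forall>n m. strict_mono n \<and> strict_mono m \<and> (\<forall>k. n k < m k) \<longrightarrow> (\<lambda>k. d (x (n k)) (x (m k))) \<in> N)"

definition complete_space ::
    "(nat \<Rightarrow> 'm::partially_ordered_monoid) set \<Rightarrow> 'a set \<Rightarrow> ('a \<Rightarrow> 'a \<Rightarrow> 'm) \<Rightarrow> bool"
  where "complete_space N X d \<longleftrightarrow>
    (\<forall>x. Cauchy_sequence N X d x \<longrightarrow> (\<exists>l\<in>X. converges_to N X d x l))"

text \<open>The additional assumption of \<open>FM_space\<close> is the strong Frechet--Wilson property; the list
  \<open>[n k..<m k]\<close> is the summation range from \<open>n k\<close> to \<open>m k - 1\<close>.\<close>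

locale FM_space = null_sequences N + distance_space X d
  for N :: "(nat \<Rightarrow> 'm::partially_ordered_monoid) set"
    and X :: "'a set" and d :: "'a \<Rightarrow> 'a \<Rightarrow> 'm" +
  assumes strong_Frechet_Wilson:
    "range x \<subseteq> X \<Longrightarrow> strict_mono n \<Longrightarrow> strict_mono m \<Longrightarrow> (\<And>k. n k < m k) \<Longrightarrow>
      (\<lambda>k. sum_list (map (\<lambda>s. d (x s) (x (Suc s))) [n k..<m k])) \<in> N \<Longrightarrow>
      (\<lambda>k. d (x (n k)) (x (m k))) \<in> N"

text \<open>Maps from the nonnegative cone to itself are total functions constrained only there.
  The series of iterates starts with the first iterate \<open>\<Lambda> \<alpha>\<close>, not with \<open>\<alpha>\<close>.\<close>

definition comparison_maps ::
    "(nat \<Rightarrow> 'm::partially_ordered_monoid) set \<Rightarrow> ('m \<Rightarrow> 'm) set" where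
  "comparison_maps N = {\<Lambda>.
    (\<forall>x. 0 \<le> x \<longrightarrow> 0 \<le> \<Lambda> x) \<and>
    (\<forall>x y. 0 \<le> x \<and> x \<le> y \<longrightarrow> \<Lambda> x \<le> \<Lambda> y) \<and>
    (\<forall>x\<in>N. (\<lambda>n. \<Lambda> (x n)) \<in> N) \<and>
    (\<forall>\<alpha>. 0 \<le> \<alpha> \<longrightarrow> Cauchy_series N (\<lambda>n. (\<Lambda> ^^ Suc n) \<alpha>))}"

end

theory Submission imports Defs begin

text \<open>The distances between consecutive points of an orbit are dominated by the terms of the
  Cauchy series of iterates of \<open>\<Lambda>\<close>, so the strong Frechet--Wilson property makes the orbit a
  Cauchy sequence. The same property, applied to the sequence
  \<open>p, x\<^sub>0, q, p, x\<^sub>1, q, \<dots>\<close>, shows that a sequence \<open>x\<close> cannot have two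
  limits \<open>p\<close> and \<open>q\<close>. Hence the limit of an orbit is a fixed point. Two fixed points have a
  distance dominated by every iterate \<open>\<Lambda>\<^sup>n\<close> of it, and these iterates form a null sequence.\<close>

lemma sum_list_nonneg_po:
  fixes g :: "'b \<Rightarrow> 'm::partially_ordered_monoid"
  assumes "\<And>s. s \<in> set xs \<Longrightarrow> 0 \<le> g s"
  shows "0 \<le> sum_list (map g xs)"
  using assms
proof (induction xs)
  case (Cons a xs)
  then have "0 + 0 \<le> g a + sum_list (map g xs)" by (intro po_add_mono) auto
  then show ?case by simp
qed simp

lemma sum_list_mono_po:
  fixes g h :: "'b \<Rightarrow> 'm::partially_ordered_monoid"
  assumes "\<And>s. s \<in> set xs \<Longrightarrow> g s \<le> h s"
  shows "sum_list (map g xs) \<le> sum_list (map h xs)"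
  using assms by (induction xs) (auto intro: po_add_mono)

text \<open>Choosing the identity for both index sequences shrinks every block to a single
  term.\<close>

lemma Cauchy_series_terms:
  assumes "Cauchy_series N a"
  shows "a \<in> N"
proof -
  have "strict_mono (\<lambda>k::nat. k)" by (simp add: strict_mono_def)
  then have "(\<lambda>k. sum_list (map a [k..<Suc k])) \<in> N"
    using assms unfolding Cauchy_series_def by blast
  then show ?thesis by simp
qed

context FM_space
begin

lemma limit_unique:
  assumes "converges_to N X d x p" and "converges_to N X d x q"
  shows "p = q"
proof -
  have X: "p \<in> X" "q \<in> X" "\<And>n. x n \<in> X"
    and null: "(\<lambda>n. d (x n) p) \<in> N" "(\<lambda>n. d (x n) q) \<in> N"
    using assms unfolding converges_to_def by auto
  define z where "z i = (if i mod 3 = 0 then p else if i mod 3 = 1 then x (i div 3) else q)" for i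
  have z: "z (3 * k) = p" "z (Suc (3 * k)) = x k" "z (Suc (Suc (3 * k))) = q" for k
  proof -
    have "Suc (3 * k) mod 3 = 1" "Suc (3 * k) div 3 = k" "Suc (Suc (3 * k)) mod 3 = 2"
      by presburger+
    then show "z (3 * k) = p" "z (Suc (3 * k)) = x k" "z (Suc (Suc (3 * k))) = q"
      by (simp_all add: z_def)
  qed
  have sum: "sum_list (map (\<lambda>s. d (z s) (z (Suc s))) [3 * k..<Suc (Suc (3 * k))])
      = d (x k) p + d (x k) q" for k
  proof -
    have "[3 * k..<Suc (Suc (3 * k))] = [3 * k, Suc (3 * k)]"
      by (simp add: upt_rec)
    then show ?thesis using X dist_sym by (simp add: z)
  qed
  \<comment> \<open>Each block runs from \<open>p\<close> through \<open>x k\<close> to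
    \<open>q\<close>, so its endpoints are at distance \<open>d p q\<close> for every
    \<open>k\<close>. The null sequence obtained is therefore constant.\<close>
  have "(\<lambda>k. d (z (3 * k)) (z (Suc (Suc (3 * k))))) \<in> N"
  proof (rule strong_Frechet_Wilson)
    show "(\<lambda>k. sum_list (map (\<lambda>s. d (z s) (z (Suc s))) [3 * k..<Suc (Suc (3 * k))])) \<in> N"
      unfolding sum using add[OF null] .
  qed (use X in \<open>auto simp: z_def strict_mono_def\<close>)
  then have "d p q = 0"
    using const_imp_zero dist_nonneg X by (simp add: z)
  then show ?thesis using X dist_eq_zero by blast
qed

text \<open>Ordered sums are monotone termwise, so each block of consecutive distances lies below
  the same block of \<open>a\<close> and inherits nullity by domination.\<close>

lemma Cauchy_sequence_if_dominated:
  assumes "range x \<subseteq> X" and "Cauchy_series N a"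
    and le: "\<And>s. d (x s) (x (Suc s)) \<le> a s"
  shows "Cauchy_sequence N X d x"
  unfolding Cauchy_sequence_def
proof (intro conjI allI impI)
  show "range x \<subseteq> X" by fact
  fix n m :: "nat \<Rightarrow> nat"
  assume nm: "strict_mono n \<and> strict_mono m \<and> (\<forall>k. n k < m k)"
  then have lt: "\<And>k. n k < m k" by blast
  \<comment> \<open>Blocks of a Cauchy series include their upper index, Frechet-Wilson sums exclude
    it; hence the series is tested with \<open>m k - 1\<close>. Since \<open>n k < m k\<close>, the
    natural subtraction does not truncate.\<close>
  have m1: "Suc (m k - 1) = m k" for k using lt[of k] by simp
  have "m i - 1 < m j - 1" if "i < j" for i j
    using nm that m1[of i] m1[of j] unfolding strict_mono_def
    by (metis Suc_less_eq)
  then have "strict_mono (\<lambda>k. m k - 1)" by (rule strict_monoI)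
  moreover have "n k \<le> m k - 1" for k using lt[of k] by simp
  ultimately have "(\<lambda>k. sum_list (map a [n k..<Suc (m k - 1)])) \<in> N"
    using assms(2) nm unfolding Cauchy_series_def by blast
  then have null: "(\<lambda>k. sum_list (map a [n k..<m k])) \<in> N" unfolding m1 .
  have "(\<lambda>k. sum_list (map (\<lambda>s. d (x s) (x (Suc s))) [n k..<m k])) \<in> N"
    using null
  proof (rule dominated, intro conjI)
    show "0 \<le> sum_list (map (\<lambda>s. d (x s) (x (Suc s))) [n k..<m k])" for k
      using assms(1) by (intro sum_list_nonneg_po dist_nonneg) auto
  qed (intro sum_list_mono_po le)
  then show "(\<lambda>k. d (x (n k)) (x (m k))) \<in> N"
    using assms(1) nm by (intro strong_Frechet_Wilson) auto
qed

text \<open>Completeness gives the shifted orbit a limit \<open>p\<close>, and the contraction makes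
  \<open>f p\<close> a limit of it as well.\<close>

lemma orbit_converges_to_fixed_point:
  assumes complete: "complete_space N X d" and f: "f ` X \<subseteq> X"
    and \<Lambda>: "\<Lambda> \<in> comparison_maps N"
    and contr: "\<And>x y. x \<in> X \<Longrightarrow> y \<in> X \<Longrightarrow> d (f x) (f y) \<le> \<Lambda> (d x y)"
    and x0: "x 0 \<in> X" and x_Suc: "\<And>n. x (Suc n) = f (x n)"
  shows "\<exists>p\<in>X. f p = p \<and> converges_to N X d x p"
proof -
  have mono: "\<And>u v. 0 \<le> u \<Longrightarrow> u \<le> v \<Longrightarrow> \<Lambda> u \<le> \<Lambda> v"
    and null: "\<And>u. u \<in> N \<Longrightarrow> (\<lambda>n. \<Lambda> (u n)) \<in> N"
    and series: "\<And>\<alpha>. 0 \<le> \<alpha> \<Longrightarrow> Cauchy_series N (\<lambda>n. (\<Lambda> ^^ Suc n) \<alpha>)"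
    using \<Lambda> unfolding comparison_maps_def by blast+
  have xX: "x n \<in> X" for n
    using x0 f by (induction n) (auto simp: x_Suc)
  have le: "d (x s) (x (Suc s)) \<le> (\<Lambda> ^^ s) (d (x 0) (x 1))" for s
  proof (induction s)
    case (Suc s)
    have "d (x (Suc s)) (x (Suc (Suc s))) \<le> \<Lambda> (d (x s) (x (Suc s)))"
      using contr[OF xX xX, of s "Suc s"] by (simp add: x_Suc)
    also have "\<dots> \<le> \<Lambda> ((\<Lambda> ^^ s) (d (x 0) (x 1)))"
      using Suc xX dist_nonneg mono by blast
    finally show ?case by simp
  qed simp
  \<comment> \<open>The series of iterates starts with the first iterate, hence the shift of the orbit.\<close>
  have "Cauchy_sequence N X d (\<lambda>n. x (Suc n))"
    by (rule Cauchy_sequence_if_dominated[OF _ series[of "d (x 0) (x 1)"]])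
      (use xX le[of "Suc _"] dist_nonneg in auto)
  then obtain p where lim: "converges_to N X d (\<lambda>n. x (Suc n)) p"
    using complete unfolding complete_space_def by blast
  then have p: "p \<in> X" and nullS: "(\<lambda>n. d (x (Suc n)) p) \<in> N"
    unfolding converges_to_def by auto
  \<comment> \<open>The shift omits only the index 0, so restoring one term carries nullity over to
    the whole orbit.\<close>
  have "- range Suc = {0}" by (auto simp: image_iff) (metis not0_implies_Suc)
  then have null_p: "(\<lambda>n. d (x n) p) \<in> N"
    using add_finite[of "\<lambda>n. d (x n) p" Suc] nullS xX p dist_nonneg
    by (simp add: strict_mono_Suc_iff)
  have "f p \<in> X" using f p by blast
  \<comment> \<open>The dominating sequence is \<open>\<Lambda> (d (x n) p)\<close>, null because
    \<open>\<Lambda>\<close> preserves null sequences.\<close>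
  moreover have "(\<lambda>n. d (x (Suc n)) (f p)) \<in> N"
    using null[OF null_p]
    by (rule dominated) (use contr xX p \<open>f p \<in> X\<close> dist_nonneg x_Suc in metis)
  ultimately have "converges_to N X d (\<lambda>n. x (Suc n)) (f p)"
    using xX unfolding converges_to_def by auto
  then have "f p = p" using lim limit_unique by blast
  then show ?thesis
    using p xX null_p unfolding converges_to_def by blast
qed

lemma fixed_point_unique:
  assumes \<Lambda>: "\<Lambda> \<in> comparison_maps N"
    and contr: "\<And>x y. x \<in> X \<Longrightarrow> y \<in> X \<Longrightarrow> d (f x) (f y) \<le> \<Lambda> (d x y)"
    and p: "p \<in> X" "f p = p" and q: "q \<in> X" "f q = q"
  shows "p = q"
proof -
  have mono: "\<And>u v. 0 \<le> u \<Longrightarrow> u \<le> v \<Longrightarrow> \<Lambda> u \<le> \<Lambda> v"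
    and series: "\<And>\<alpha>. 0 \<le> \<alpha> \<Longrightarrow> Cauchy_series N (\<lambda>n. (\<Lambda> ^^ Suc n) \<alpha>)"
    using \<Lambda> unfolding comparison_maps_def by blast+
  have nonneg: "0 \<le> d p q" using p q dist_nonneg by blast
  have step: "d p q \<le> \<Lambda> (d p q)" using contr[of p q] p q by simp
  have le: "d p q \<le> (\<Lambda> ^^ n) (d p q)" for n
  proof (induction n)
    case (Suc n)
    then have "\<Lambda> (d p q) \<le> \<Lambda> ((\<Lambda> ^^ n) (d p q))" using mono nonneg by blast
    then show ?case using step by (simp add: order_trans)
  qed simp
  \<comment> \<open>The constant sequence lies below the iterates, which are null as the terms of a
    Cauchy series.\<close>
  have "(\<lambda>n. d p q) \<in> N"
    by (rule dominated[OF Cauchy_series_terms[OF series[OF nonneg]]]) (use nonneg le in blast)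
  then have "d p q = 0" using const_imp_zero nonneg by blast
  then show ?thesis using p q dist_eq_zero by blast
qed

end

theorem theorem1:
  fixes N :: "(nat \<Rightarrow> 'm::partially_ordered_monoid) set"
    and X :: "'a set" and d :: "'a \<Rightarrow> 'a \<Rightarrow> 'm" and f :: "'a \<Rightarrow> 'a"
  assumes "null_sequences N"
    and "FM_space N X d"
    and "complete_space N X d"
    and "X \<noteq> {}"
    and "f ` X \<subseteq> X"
    and "\<exists>\<Lambda>\<in>comparison_maps N. \<forall>x\<in>X. \<forall>y\<in>X. d (f x) (f y) \<le> \<Lambda> (d x y)"
  shows "\<exists>p. p \<in> X \<and> f p = p \<and> (\<forall>q\<in>X. f q = q \<longrightarrow> q = p) \<and>
    (\<forall>x. x 0 \<in> X \<and> (\<forall>n\<ge>1. x n = f (x (n - 1))) \<longrightarrow>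
      converges_to N X d x p \<and> (\<forall>l. converges_to N X d x l \<longrightarrow> l = p))"
proof -
  interpret FM_space N X d by fact
  obtain \<Lambda> where \<Lambda>: "\<Lambda> \<in> comparison_maps N"
    and contr: "\<And>x y. x \<in> X \<Longrightarrow> y \<in> X \<Longrightarrow> d (f x) (f y) \<le> \<Lambda> (d x y)"
    using assms(6) by blast
  have orbit: "\<exists>p\<in>X. f p = p \<and> converges_to N X d x p"
    if "x 0 \<in> X" "\<And>n. x (Suc n) = f (x n)" for x
    using assms(3,5) \<Lambda> contr that by (rule orbit_converges_to_fixed_point)
  have unique: "p = q" if "p \<in> X" "f p = p" "q \<in> X" "f q = q" for p q
    using \<Lambda> contr that by (rule fixed_point_unique)
  \<comment> \<open>The orbit of an arbitrary point yields \<open>p\<close>. Any other orbit has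
    some fixed point as its limit, and uniqueness identifies that point with
    \<open>p\<close>.\<close>
  obtain c where "c \<in> X" using assms(4) by blast
  then obtain p where p: "p \<in> X" "f p = p"
    using orbit[of "\<lambda>n. (f ^^ n) c"] by auto
  have "converges_to N X d x p" if x: "x 0 \<in> X" "\<forall>n\<ge>1. x n = f (x (n - 1))" for x
  proof -
    have x_Suc: "x (Suc n) = f (x n)" for n using x(2) by simp
    obtain p' where "p' \<in> X" "f p' = p'" "converges_to N X d x p'"
      using orbit[OF x(1) x_Suc] by blast
    then show ?thesis using unique[of p' p] p by simp
  qed
  then show ?thesis using p unique limit_unique by blast
qed

end
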